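(* Let $\mathcal{G}$ be a $k$-uniform hypergraph. Then the number of connected components of $\mathcal{G}$ equals the geometry connectivity $\beta(\mathcal{G})$, i.e. the maximum number of linearly independent nonnegative eigenvectors of the Laplacian tensor $\mathcal{L}_{\mathcal{G}}$ corresponding to the eigenvalue $0$.
   Context: A $k$-uniform hypergraph $\mathcal{G}$ has vertex set $V(\mathcal{G})=[n]=\{1,\dots,n\}$ and an edge set $E(\mathcal{G})$ of $k$-element subsets of $[n]$; $d_i$ is the number of edges containing vertex $i$. A path is an alternating sequence $v_0e_1v_1\cdots e_lv_l$ of distinct vertices and distinct edges with $v_{i-1},v_i\in e_i$. For $X\subseteq V$, $\mathcal{G}(X)$ is the induced sub-hypergraph; it is a connected component if any two vertices of $X$ are joined by a path in $\mathcal{G}(X)$ and no path joins a vertex of $X$ to a vertex of $V\setminus X$. The adjacency tensor $\mathcal{A}_{\mathcal{G}}=(a_{i_1\cdots i_k})$ is the $k$-order $n$-dimensional tensor with $a_{i_1\cdots i_k}=\frac{1}{(k-1)!}$ if $\{i_1,\dots,i_k\}\in E(\mathcal{G})$ and $0$ otherwise. The Laplacian tensor is $\mathcal{L}_{\mathcal{G}}=\mathcal{D}_{\mathcal{G}}-\mathcal{A}_{\mathcal{G}}$, where $\mathcal{D}_{\mathcal{G}}$ is the diagonal $k$-order tensor with diagonal entries $d_1,\dots,d_n$. For a $k$-order $n$-dimensional tensor $\mathcal{T}=(t_{i_1\cdots i_k})$ and $x\in\mathbb{C}^n$, $\mathcal{T}x^{k-1}\in\mathbb{C}^n$ has $i$-th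 entry $\sum_{i_2,\dots,i_k=1}^n t_{i i_2\cdots i_k}x_{i_2}\cdots x_{i_k}$; $\lambda$ is an eigenvalue with eigenvector $x\neq 0$ if $\mathcal{T}x^{k-1}=\lambda x^{[k-1]}$, where $x^{[k-1]}=(x_1^{k-1},\dots,x_n^{k-1})^{\mathrm T}$. The geometry connectivity $\beta(\mathcal{G})$ is the maximum number of linearly independent nonnegative vectors $x\in\mathbb{R}^n_+\setminus\{0\}$ with $\mathcal{L}_{\mathcal{G}}x^{k-1}=0$. *)

theory Defs
  imports "HOL-Analysis.Analysis"
begin

definition uniform_hypergraph :: "nat \<Rightarrow> 'v set \<Rightarrow> 'v set set \<Rightarrow> bool" where
  "uniform_hypergraph k V E \<longleftrightarrow> finite V \<and> (\<forall>e\<in>E. e \<subseteq> V \<and> card e = k)"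

definition vertex_degree :: "'v set set \<Rightarrow> 'v \<Rightarrow> nat" where
  "vertex_degree E i = card {e \<in> E. i \<in> e}"

text \<open>The alternating sequence \<open>v\<^sub>0 e\<^sub>1 v\<^sub>1 \<dots> e\<^sub>l v\<^sub>l\<close> is split into its vertex list
  \<open>vs\<close> and its edge list \<open>es\<close>; \<open>l = 0\<close> is allowed, so a vertex is joined to itself.\<close>

definition hpath :: "'v set \<Rightarrow> 'v set set \<Rightarrow> 'v list \<Rightarrow> 'v set list \<Rightarrow> bool" where
  "hpath V E vs es \<longleftrightarrow>
     length vs = length es + 1 \<and> set vs \<subseteq> V \<and> set es \<subseteq> E \<and> distinct vs \<and> distinct es \<and>
     (\<forall>i < length es. vs ! i \<in> es ! i \<and> vs ! (i + 1) \<in> es ! i)"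

definition joined :: "'v set \<Rightarrow> 'v set set \<Rightarrow> 'v \<Rightarrow> 'v \<Rightarrow> bool" where
  "joined V E u v \<longleftrightarrow> (\<exists>vs es. hpath V E vs es \<and> hd vs = u \<and> last vs = v)"

definition induced_edges :: "'v set set \<Rightarrow> 'v set \<Rightarrow> 'v set set" where
  "induced_edges E X = {e \<in> E. e \<subseteq> X}"

definition connected_component_of_hypergraph :: "'v set \<Rightarrow> 'v set set \<Rightarrow> 'v set \<Rightarrow> bool" where
  "connected_component_of_hypergraph V E X \<longleftrightarrow>
     X \<subseteq> V \<and> X \<noteq> {} \<and>
     (\<forall>u\<in>X. \<forall>v\<in>X. joined X (induced_edges E X) u v) \<and>
     (\<forall>u\<in>X. \<forall>v\<in>V - X. \<not> joined V E u v)"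

definition num_components :: "'v set \<Rightarrow> 'v set set \<Rightarrow> nat" where
  "num_components V E = card {X. connected_component_of_hypergraph V E X}"

text \<open>A tensor of order \<open>k\<close> and dimension \<open>CARD('n)\<close> is a function on index lists, of which
  only the values at lists of length \<open>k\<close> matter.\<close>

type_synonym ('n, 'a) tensor = "'n list \<Rightarrow> 'a"

definition tensor_apply ::
  "nat \<Rightarrow> ('n::finite, 'a::comm_semiring_1) tensor \<Rightarrow> 'a ^ 'n \<Rightarrow> 'a ^ 'n" where
  "tensor_apply k T x =
     (\<chi> i. \<Sum>js\<in>{js. length js = k - 1}. T (i # js) * (\<Prod>j\<leftarrow>js. x $ j))"

definition is_eigenpair ::
  "nat \<Rightarrow> ('n::finite, complex) tensor \<Rightarrow> complex \<Rightarrow> complex ^ 'n \<Rightarrow> bool" where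
  "is_eigenpair k T \<mu> x \<longleftrightarrow> x \<noteq> 0 \<and> tensor_apply k T x = (\<chi> i. \<mu> * (x $ i) ^ (k - 1))"

definition adjacency_tensor :: "nat \<Rightarrow> 'n set set \<Rightarrow> ('n, 'a::field_char_0) tensor" where
  "adjacency_tensor k E is = (if set is \<in> E then 1 / fact (k - 1) else 0)"

definition degree_tensor :: "'n set set \<Rightarrow> ('n, 'a::field_char_0) tensor" where
  "degree_tensor E is =
     (if \<forall>j\<in>set is. j = hd is then of_nat (vertex_degree E (hd is)) else 0)"

definition laplacian_tensor :: "nat \<Rightarrow> 'n set set \<Rightarrow> ('n, 'a::field_char_0) tensor" where
  "laplacian_tensor k E is = degree_tensor E is - adjacency_tensor k E is"

text \<open>The set of cardinalities is nonempty and bounded by \<open>CARD('n)\<close>, so \<open>Max\<close> is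
  meaningful.\<close>

definition max_independent :: "(real ^ 'n::finite) set \<Rightarrow> nat" where
  "max_independent A = Max {card S | S. S \<subseteq> A \<and> independent S}"

definition geometry_connectivity :: "nat \<Rightarrow> 'n::finite set set \<Rightarrow> nat" where
  "geometry_connectivity k E =
     max_independent {x :: real ^ 'n. x \<noteq> 0 \<and> (\<forall>i. 0 \<le> x $ i) \<and>
       tensor_apply k (laplacian_tensor k E) x = 0}"

definition complex_vec :: "real ^ 'n \<Rightarrow> complex ^ 'n" where
  "complex_vec x = (\<chi> i. complex_of_real (x $ i))"

end

theory Submission imports Defs "HOL-Combinatorics.Multiset_Permutations" begin

text \<open>Entry \<open>i\<close> of the Laplacian image of \<open>x\<close> is
  \<open>d\<^sub>i x\<^sub>i\<^sup>k\<^sup>-\<^sup>1 - (\<Sum>e\<ni>i. \<Prod>j\<in>e-{i}. x\<^sub>j)\<close>. By a maximum principle, a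
  nonnegative \<open>x\<close> is a null vector iff it is constant on every edge, i.e. on every
  connected component. The indicator vectors of the components are orthogonal nonnegative null
  vectors, and they span the space of all vectors that are constant on edges.\<close>

section \<open>Connected components as equivalence classes\<close>

text \<open>Sharing an edge, without the distinctness demands of a path. Chains of this relation may
  revisit vertices and edges, so the closure is an equivalence; being reflexive, it also covers
  vertices that lie in no edge.\<close>

definition edge_adjacency :: "'v set set \<Rightarrow> 'v rel" where
  "edge_adjacency E = {(u, v). \<exists>e\<in>E. u \<in> e \<and> v \<in> e}"

lemma equiv_edge_adjacency_rtrancl: "equiv UNIV ((edge_adjacency E)\<^sup>*)"
proof (rule equivI)
  have "sym (edge_adjacency E)"
    by (auto simp: edge_adjacency_def sym_def)
  then show "sym ((edge_adjacency E)\<^sup>*)"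
    by (rule sym_rtrancl)
qed (auto simp: refl_rtrancl trans_rtrancl)

lemma joined_refl: "u \<in> V \<Longrightarrow> joined V E u u"
  unfolding joined_def hpath_def by (rule exI[of _ "[u]"], rule exI[of _ "[]"]) auto

lemma hpath_take:
  assumes "hpath V E vs es" "i \<le> length es"
  shows "hpath V E (take (Suc i) vs) (take i es)"
  using assms set_take_subset[of "Suc i" vs] set_take_subset[of i es]
  unfolding hpath_def by auto

text \<open>Leaving the path at its first vertex that lies in the new edge keeps both vertices and edges
  distinct.\<close>

lemma joined_step:
  assumes "joined V E u v" "e \<in> E" "v \<in> e" "w \<in> e" "w \<in> V"
  shows "joined V E u w"
proof -
  obtain vs es where p: "hpath V E vs es" and u: "hd vs = u" and v: "last vs = v"
    using assms(1) unfolding joined_def by blast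
  have len: "length vs = Suc (length es)"
    using p by (simp add: hpath_def)
  \<comment> \<open>The bound on the index matters, since \<open>!\<close> is unspecified beyond the
    end of the list.\<close>
  define P where "P i \<longleftrightarrow> i < length vs \<and> vs ! i \<in> e" for i
  have "P (length es)"
    using v len assms(3) last_conv_nth[of vs] unfolding P_def by force
  then have Pi: "P (LEAST i. P i)"
    by (rule LeastI)
  define i where "i = (LEAST i. P i)"
  have i: "i < length vs" "vs ! i \<in> e"
    using Pi unfolding i_def P_def by auto
  have least: "vs ! j \<notin> e" if "j < i" for j
    using that not_less_Least[of j P] i(1) unfolding i_def P_def by auto
  define vs' es' where "vs' = take (Suc i) vs" and "es' = take i es"
  have p': "hpath V E vs' es'"
    unfolding vs'_def es'_def using hpath_take[OF p] i(1) len by simp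
  have hd': "hd vs' = u"
    using u len unfolding vs'_def by (cases vs) auto
  have len': "length vs' = Suc i" "length es' = i"
    using i(1) len unfolding vs'_def es'_def by auto
  have last': "last vs' = vs ! i"
    using len' i(1) by (subst last_conv_nth) (auto simp: vs'_def)
  show ?thesis
  proof (cases "w = vs ! i")
    case True
    then show ?thesis
      using p' hd' last' unfolding joined_def by blast
  next
    case False
    have "w \<notin> set vs'"
    proof
      assume "w \<in> set vs'"
      then obtain j where "j < Suc i" "w = vs ! j"
        using len' unfolding vs'_def by (auto simp: in_set_conv_nth)
      then show False
        using least[of j] False assms(4) by (cases "j = i") auto
    qed
    \<comment> \<open>The edge \<open>es ! j\<close> contains \<open>vs ! j\<close>, which for
      \<open>j < i\<close> lies outside \<open>e\<close> by minimality of \<open>i\<close>.\<close>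
    moreover have "e \<notin> set es'"
    proof
      assume "e \<in> set es'"
      then obtain j where "j < i" "e = es ! j"
        using len' unfolding es'_def by (auto simp: in_set_conv_nth)
      then show False
        using least[of j] p i(1) len unfolding hpath_def by auto
    qed
    moreover have "vs' ! i \<in> e"
      using i by (simp add: vs'_def)
    ultimately have "hpath V E (vs' @ [w]) (es' @ [e])"
      using p' len' assms(2,4,5) unfolding hpath_def by (auto simp: nth_append less_Suc_eq)
    moreover have "hd (vs' @ [w]) = u"
      using hd' len' by (cases vs') auto
    ultimately show ?thesis
      unfolding joined_def by (metis last_snoc)
  qed
qed

lemma joined_imp_rtrancl:
  assumes "joined V E u v"
  shows "(u, v) \<in> (edge_adjacency E)\<^sup>*"
proof -
  obtain vs es where p: "hpath V E vs es" and u: "hd vs = u" and v: "last vs = v"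
    using assms unfolding joined_def by blast
  have ne: "vs \<noteq> []" and len: "length vs = Suc (length es)"
    using p by (auto simp: hpath_def)
  have "(vs ! 0, vs ! i) \<in> (edge_adjacency E)\<^sup>*" if "i \<le> length es" for i
    using that
  proof (induction i)
    case (Suc i)
    have "es ! i \<in> E" "vs ! i \<in> es ! i" "vs ! Suc i \<in> es ! i"
      using p Suc.prems unfolding hpath_def by (auto simp: subset_iff)
    then have "(vs ! i, vs ! Suc i) \<in> edge_adjacency E"
      unfolding edge_adjacency_def by blast
    then show ?case
      using Suc by (meson Suc_leD rtrancl.rtrancl_into_rtrancl)
  qed simp
  from this[of "length es"] show ?thesis
    using u v ne len by (simp add: hd_conv_nth last_conv_nth)
qed

text \<open>A chain starting in \<open>X\<close> cannot leave it, because \<open>X\<close> contains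
  every edge that it meets; hence \<open>joined_step\<close> applies inside the induced hypergraph.
  \<open>X = UNIV\<close> yields plain joining, while an equivalence class yields connectedness of a
  component.\<close>

lemma rtrancl_imp_joined:
  assumes "(u, v) \<in> (edge_adjacency E)\<^sup>*" "u \<in> X"
    and closed: "\<And>e w. e \<in> E \<Longrightarrow> w \<in> e \<Longrightarrow> w \<in> X \<Longrightarrow> e \<subseteq> X"
  shows "v \<in> X \<and> joined X (induced_edges E X) u v"
  using assms(1)
proof induction
  case base
  show ?case
    by (intro conjI joined_refl assms(2))
next
  case (step y z)
  obtain e where e: "e \<in> E" "y \<in> e" "z \<in> e"
    using step.hyps(2) unfolding edge_adjacency_def by blast
  moreover have "e \<subseteq> X"
    by (rule closed[OF e(1,2)]) (simp add: step.IH)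
  ultimately have "e \<in> induced_edges E X" "z \<in> X"
    by (auto simp: induced_edges_def)
  then show ?case
    using step.IH joined_step e by metis
qed

lemma edge_adjacency_mono: "E \<subseteq> F \<Longrightarrow> edge_adjacency E \<subseteq> edge_adjacency F"
  unfolding edge_adjacency_def by blast

text \<open>For a component \<open>X\<close> and \<open>u\<close> in \<open>X\<close>, connectedness
  puts \<open>X\<close> inside the class of \<open>u\<close>, and separation puts the class inside
  \<open>X\<close>. Conversely, a class contains every edge that it meets, and paths never leave a
  class.\<close>

lemma components_eq_quotient:
  "{X. connected_component_of_hypergraph UNIV E X} = UNIV // (edge_adjacency E)\<^sup>*"
  (is "_ = UNIV // ?R")
proof (intro set_eqI iffI)
  fix X
  assume "X \<in> {X. connected_component_of_hypergraph UNIV E X}"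
  then have ne: "X \<noteq> {}"
    and conn: "\<And>u v. u \<in> X \<Longrightarrow> v \<in> X \<Longrightarrow> joined X (induced_edges E X) u v"
    and sep: "\<And>u v. u \<in> X \<Longrightarrow> v \<notin> X \<Longrightarrow> \<not> joined UNIV E u v"
    unfolding connected_component_of_hypergraph_def by auto
  obtain u where u: "u \<in> X"
    using ne by blast
  have "(edge_adjacency (induced_edges E X))\<^sup>* \<subseteq> ?R"
    by (intro rtrancl_mono edge_adjacency_mono) (auto simp: induced_edges_def)
  then have "(u, v) \<in> ?R" if "v \<in> X" for v
    using joined_imp_rtrancl[OF conn[OF u that]] by (rule subsetD)
  then have "X \<subseteq> ?R `` {u}"
    by (intro subsetI ImageI[of u]) simp_all
  moreover have "joined UNIV E u v" if "(u, v) \<in> ?R" for v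
    using rtrancl_imp_joined[OF that, of UNIV] by (simp add: induced_edges_def)
  then have "?R `` {u} \<subseteq> X"
    using sep[OF u] by blast
  ultimately have "X = ?R `` {u}"
    by (rule equalityI)
  then show "X \<in> UNIV // ?R"
    by (simp add: quotientI)
next
  fix X
  assume X: "X \<in> UNIV // ?R"
  then obtain r where r: "X = ?R `` {r}"
    by (rule quotientE)
  have rel: "(u, v) \<in> ?R" if "u \<in> X" "v \<in> X" for u v
    using that X equiv_edge_adjacency_rtrancl[of E]
    by (meson in_quotient_imp_in_rel insert_subset empty_subsetI)
  have closed: "e \<subseteq> X" if "e \<in> E" "w \<in> e" "w \<in> X" for e w
  proof
    fix z assume "z \<in> e"
    then have "(w, z) \<in> edge_adjacency E"
      using that unfolding edge_adjacency_def by blast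
    then show "z \<in> X"
      using that(3) unfolding r by (auto intro: rtrancl.rtrancl_into_rtrancl)
  qed
  have "joined X (induced_edges E X) u v" if "u \<in> X" "v \<in> X" for u v
    by (rule rtrancl_imp_joined[OF rel[OF that] that(1), THEN conjunct2]) (rule closed)
  moreover have "\<not> joined UNIV E u v" if "u \<in> X" "v \<notin> X" for u v
  proof
    assume "joined UNIV E u v"
    then have "(u, v) \<in> ?R"
      by (rule joined_imp_rtrancl)
    moreover have "(r, u) \<in> ?R"
      using that(1) unfolding r by simp
    ultimately have "(r, v) \<in> ?R"
      by (meson rtrancl_trans)
    then show False
      using that(2) unfolding r by simp
  qed
  moreover have "X \<noteq> {}"
    unfolding r by blast
  ultimately show "X \<in> {X. connected_component_of_hypergraph UNIV E X}"
    unfolding connected_component_of_hypergraph_def by blast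
qed

section \<open>Nonnegative null vectors of the Laplacian tensor\<close>

lemma lists_onto_edge_eq_permutations:
  assumes "card e = k" "i \<in> e" "finite e"
  shows "{js. length js = k - 1 \<and> set (i # js) = e} = permutations_of_set (e - {i})"
proof (intro set_eqI iffI)
  fix js
  assume "js \<in> {js. length js = k - 1 \<and> set (i # js) = e}"
  then have js: "length js = k - 1" "set (i # js) = e"
    by auto
  \<comment> \<open>Membership of \<open>i\<close> in \<open>e\<close> excludes
    \<open>k = 0\<close>, so truncated subtraction is harmless and \<open>i # js\<close> has exactly
    \<open>k = card e\<close> entries, which forces distinctness.\<close>
  have "k > 0"
    using assms card_gt_0_iff by blast
  then have "distinct (i # js)"
    using js assms(1) by (intro card_distinct) simp
  then show "js \<in> permutations_of_set (e - {i})"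
    using js by (auto simp: permutations_of_set_def)
next
  fix js
  assume "js \<in> permutations_of_set (e - {i})"
  then have "set js = e - {i}" "distinct js"
    by (auto simp: permutations_of_set_def)
  then show "js \<in> {js. length js = k - 1 \<and> set (i # js) = e}"
    using assms distinct_card[of js] by auto
qed

text \<open>Only lists whose support together with \<open>i\<close> is an edge contribute. Grouped
  by that edge, they are the orderings of \<open>e - {i}\<close>, and all of them give the same
  product.\<close>

lemma sum_adjacency_tensor:
  fixes x :: "'a::field_char_0 ^ 'n::finite"
  assumes "\<forall>e\<in>E. card e = k"
  shows "(\<Sum>js\<in>{js. length js = k - 1}. adjacency_tensor k E (i # js) * (\<Prod>j\<leftarrow>js. x $ j))
    = (\<Sum>e\<in>{e\<in>E. i \<in> e}. \<Prod>j\<in>e - {i}. x $ j)"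
proof -
  let ?L = "{js :: 'n list. length js = k - 1}"
  let ?f = "\<lambda>js. adjacency_tensor k E (i # js) * (\<Prod>j\<leftarrow>js. x $ j)"
  have fin: "finite ?L"
    using finite_lists_length_eq[of "UNIV :: 'n set" "k - 1"] by simp
  have "sum ?f ?L = sum ?f {js \<in> ?L. set (i # js) \<in> {e\<in>E. i \<in> e}}"
    using fin by (intro sum.mono_neutral_right) (auto simp: adjacency_tensor_def)
  also have "\<dots> = (\<Sum>e\<in>{e\<in>E. i \<in> e}.
      sum ?f {js \<in> {js \<in> ?L. set (i # js) \<in> {e\<in>E. i \<in> e}}. set (i # js) = e})"
    using fin by (intro sum.group[symmetric]) auto
  also have "\<dots> = (\<Sum>e\<in>{e\<in>E. i \<in> e}. \<Prod>j\<in>e - {i}. x $ j)"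
  proof (rule sum.cong[OF refl])
    fix e assume e: "e \<in> {e\<in>E. i \<in> e}"
    have "{js \<in> {js \<in> ?L. set (i # js) \<in> {e\<in>E. i \<in> e}}. set (i # js) = e}
        = {js. length js = k - 1 \<and> set (i # js) = e}"
      using e by auto
    then have "sum ?f {js \<in> {js \<in> ?L. set (i # js) \<in> {e\<in>E. i \<in> e}}. set (i # js) = e}
        = sum ?f (permutations_of_set (e - {i}))"
      using e assms lists_onto_edge_eq_permutations[of e k i] by simp
    also have "\<dots> = (\<Sum>js\<in>permutations_of_set (e - {i}).
        1 / fact (k - 1) * (\<Prod>j\<in>e - {i}. x $ j))"
    proof (rule sum.cong[OF refl])
      fix js assume "js \<in> permutations_of_set (e - {i})"
      then have js: "set js = e - {i}" "distinct js"
        by (auto simp: permutations_of_set_def)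
      then have "set (i # js) = e"
        using e by auto
      moreover have "(\<Prod>j\<leftarrow>js. x $ j) = (\<Prod>j\<in>e - {i}. x $ j)"
        using js by (metis prod.distinct_set_conv_list)
      ultimately show "?f js = 1 / fact (k - 1) * (\<Prod>j\<in>e - {i}. x $ j)"
        using e by (simp add: adjacency_tensor_def)
    qed
    \<comment> \<open>There are \<open>fact (k - 1)\<close> orderings, which cancels the
      normalisation of the adjacency tensor.\<close>
    also have "\<dots> = (\<Prod>j\<in>e - {i}. x $ j)"
      using e assms by simp
    finally show "sum ?f {js \<in> {js \<in> ?L. set (i # js) \<in> {e\<in>E. i \<in> e}}. set (i # js) = e}
        = (\<Prod>j\<in>e - {i}. x $ j)" .
  qed
  finally show ?thesis .
qed

lemma sum_degree_tensor:
  fixes x :: "'a::field_char_0 ^ 'n::finite"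
  shows "(\<Sum>js\<in>{js. length js = m}. degree_tensor E (i # js) * (\<Prod>j\<leftarrow>js. x $ j))
    = of_nat (vertex_degree E i) * (x $ i) ^ m"
proof -
  let ?f = "\<lambda>js. degree_tensor E (i # js) * (\<Prod>j\<leftarrow>js. x $ j)"
  have fin: "finite {js :: 'n list. length js = m}"
    using finite_lists_length_eq[of "UNIV :: 'n set" m] by simp
  have "sum ?f {js. length js = m} = sum ?f {replicate m i}"
  proof (rule sum.mono_neutral_right[OF fin])
    show "\<forall>js\<in>{js. length js = m} - {replicate m i}. ?f js = 0"
      by (auto simp: degree_tensor_def replicate_eqI)
  qed auto
  then show ?thesis
    by (simp add: degree_tensor_def prod_list_replicate)
qed

text \<open>Stated over any field of characteristic zero, so that it serves real null vectors and
  complex eigenvectors alike.\<close>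

lemma laplacian_apply_nth:
  fixes x :: "'a::field_char_0 ^ 'n::finite"
  assumes "\<forall>e\<in>E. card e = k"
  shows "tensor_apply k (laplacian_tensor k E) x $ i =
    of_nat (vertex_degree E i) * (x $ i) ^ (k - 1) - (\<Sum>e\<in>{e\<in>E. i \<in> e}. \<Prod>j\<in>e - {i}. x $ j)"
  using sum_adjacency_tensor[OF assms, of i x] sum_degree_tensor[where m = "k - 1" and E = E and i = i and x = x]
  by (simp add: tensor_apply_def laplacian_tensor_def left_diff_distrib sum_subtractf)

text \<open>Maximum principle: at a suitable vertex \<open>i\<close>, every edge product is at most
  \<open>x $ i ^ (k - 1)\<close> and one is strictly smaller, so row \<open>i\<close> of the
  Laplacian image is positive.\<close>

lemma laplacian_null_constant_on_edges:
  fixes x :: "real ^ 'n::finite"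
  assumes card: "\<forall>e\<in>E. card e = k"
    and nonneg: "\<And>i. 0 \<le> x $ i"
    and null: "tensor_apply k (laplacian_tensor k E) x = 0"
    and "e \<in> E" "u \<in> e" "v \<in> e"
  shows "x $ u = x $ v"
proof (rule ccontr)
  assume neq: "x $ u \<noteq> x $ v"
  \<comment> \<open>Vertices with a strictly smaller neighbour. A global maximum of \<open>x\<close>
    would not suffice, as it may lie in a component on which \<open>x\<close> is constant.\<close>
  define S where "S = {i. \<exists>e\<in>E. \<exists>j. i \<in> e \<and> j \<in> e \<and> x $ j < x $ i}"
  have "S \<noteq> {}"
    using neq assms(4-6) unfolding S_def by (metis (mono_tags, lifting) empty_iff linorder_neqE mem_Collect_eq)
  then obtain i where i: "i \<in> S" "\<And>l. l \<in> S \<Longrightarrow> x $ l \<le> x $ i"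
    using finite_has_maximal[of "(\<lambda>i. x $ i) ` S"] by (auto simp: image_iff) (metis linorder_linear)
  then obtain e0 j where e0: "e0 \<in> E" "i \<in> e0" "j \<in> e0" "x $ j < x $ i"
    unfolding S_def by blast
  have pos: "x $ i > 0"
    using nonneg[of j] e0(4) by linarith
  \<comment> \<open>A neighbour with a larger value would itself be in \<open>S\<close>, witnessed
    by \<open>i\<close>, against the maximality of \<open>i\<close>.\<close>
  have nb: "x $ l \<le> x $ i" if "e \<in> E" "i \<in> e" "l \<in> e" for e l
    using that i(2)[of l] unfolding S_def by force
  have le: "(\<Prod>l\<in>A. x $ l) \<le> (x $ i) ^ card A" if "e \<in> E" "i \<in> e" "A \<subseteq> e" for e A
    using prod_mono[of A "\<lambda>l. x $ l" "\<lambda>_. x $ i"] nonneg nb[OF that(1,2)] that(3) by auto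
  have strict: "(\<Prod>l\<in>e0 - {i}. x $ l) < (x $ i) ^ (k - 1)"
  proof -
    have ji: "j \<in> e0 - {i}"
      using e0 by auto
    have "(\<Prod>l\<in>e0 - {i}. x $ l) = x $ j * (\<Prod>l\<in>e0 - {i} - {j}. x $ l)"
      using ji by (intro prod.remove) auto
    \<comment> \<open>Bounding the other factors first leaves a power of the positive number
      \<open>x $ i\<close> as cofactor, so the next inequality is strict even if some entries
      vanish.\<close>
    also have "\<dots> \<le> x $ j * (x $ i) ^ card (e0 - {i} - {j})"
      using e0 nonneg by (intro mult_left_mono le[of e0]) auto
    also have "\<dots> < x $ i * (x $ i) ^ card (e0 - {i} - {j})"
      using e0(4) pos by simp
    also have "\<dots> = (x $ i) ^ card (e0 - {i})"
      using card.remove[OF _ ji] by simp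
    finally show ?thesis
      using e0 card by simp
  qed
  have "(\<Sum>e\<in>{e\<in>E. i \<in> e}. \<Prod>l\<in>e - {i}. x $ l) < (\<Sum>e\<in>{e\<in>E. i \<in> e}. (x $ i) ^ (k - 1))"
  proof (rule sum_strict_mono_ex1)
    show "\<forall>e\<in>{e\<in>E. i \<in> e}. (\<Prod>l\<in>e - {i}. x $ l) \<le> (x $ i) ^ (k - 1)"
    proof
      fix e assume "e \<in> {e\<in>E. i \<in> e}"
      then show "(\<Prod>l\<in>e - {i}. x $ l) \<le> (x $ i) ^ (k - 1)"
        using le[of e "e - {i}"] card by auto
    qed
    show "\<exists>e\<in>{e\<in>E. i \<in> e}. (\<Prod>l\<in>e - {i}. x $ l) < (x $ i) ^ (k - 1)"
      using e0 strict by blast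
  qed simp
  then show False
    using laplacian_apply_nth[OF card, of x i] null by (simp add: vertex_degree_def)
qed

lemma constant_on_edges_laplacian_null:
  fixes x :: "'a::field_char_0 ^ 'n::finite"
  assumes card: "\<forall>e\<in>E. card e = k"
    and const: "\<And>e u v. e \<in> E \<Longrightarrow> u \<in> e \<Longrightarrow> v \<in> e \<Longrightarrow> x $ u = x $ v"
  shows "tensor_apply k (laplacian_tensor k E) x = 0"
proof (rule vec_eq_iff[THEN iffD2, rule_format])
  fix i
  have "(\<Sum>e\<in>{e\<in>E. i \<in> e}. \<Prod>j\<in>e - {i}. x $ j) = (\<Sum>e\<in>{e\<in>E. i \<in> e}. (x $ i) ^ (k - 1))"
  proof (rule sum.cong[OF refl])
    fix e assume e: "e \<in> {e\<in>E. i \<in> e}"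
    have "(\<Prod>j\<in>e - {i}. x $ j) = (\<Prod>j\<in>e - {i}. x $ i)"
    proof (rule prod.cong[OF refl])
      fix j assume "j \<in> e - {i}"
      then show "x $ j = x $ i"
        using e by (intro const[of e]) simp_all
    qed
    then show "(\<Prod>j\<in>e - {i}. x $ j) = (x $ i) ^ (k - 1)"
      using e card by simp
  qed
  then show "tensor_apply k (laplacian_tensor k E) x $ i = 0 $ i"
    using laplacian_apply_nth[OF card, of x i] by (simp add: vertex_degree_def)
qed

section \<open>Real null vectors viewed as complex eigenvectors\<close>

lemma complex_vec_eq_0_iff: "complex_vec x = 0 \<longleftrightarrow> x = 0"
  by (simp add: complex_vec_def vec_eq_iff)

lemma laplacian_apply_complex_vec:
  assumes "\<forall>e\<in>E. card e = k"
  shows "tensor_apply k (laplacian_tensor k E) (complex_vec x) =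
    complex_vec (tensor_apply k (laplacian_tensor k E) x)"
  unfolding vec_eq_iff complex_vec_def
  by (simp add: laplacian_apply_nth[OF assms])

section \<open>Indicator vectors of the components\<close>

definition indicator_vec :: "'n set \<Rightarrow> real ^ 'n" where
  "indicator_vec X = (\<chi> i. if i \<in> X then 1 else 0)"

lemma indicator_vec_nth [simp]: "indicator_vec X $ i = (if i \<in> X then 1 else 0)"
  by (simp add: indicator_vec_def)

lemma inj_indicator_vec: "inj indicator_vec"
  by (rule injI) (auto simp: vec_eq_iff split: if_splits)

lemma indicator_vec_eq_0_iff: "indicator_vec X = 0 \<longleftrightarrow> X = {}"
  by (auto simp: vec_eq_iff)

lemma independent_indicator_vec:
  fixes Q :: "'n::finite set set"
  assumes "disjoint Q" "{} \<notin> Q"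
  shows "independent (indicator_vec ` Q)"
proof (rule pairwise_orthogonal_independent)
  show "pairwise orthogonal (indicator_vec ` Q)"
  proof (rule pairwiseI)
    fix a b assume "a \<in> indicator_vec ` Q" "b \<in> indicator_vec ` Q" "a \<noteq> b"
    then obtain X Y where XY: "X \<in> Q" "Y \<in> Q" "X \<noteq> Y" "a = indicator_vec X" "b = indicator_vec Y"
      by blast
    then have "X \<inter> Y = {}"
      using assms(1) by (simp add: disjoint_def)
    then show "orthogonal a b"
      unfolding XY orthogonal_def inner_vec_def by (intro sum.neutral) auto
  qed
  show "0 \<notin> indicator_vec ` Q"
    using assms(2) by (metis imageE indicator_vec_eq_0_iff)
qed

lemma span_indicator_vec:
  fixes x :: "real ^ 'n::finite"
  assumes "partition_on UNIV Q"
    and const: "\<And>X u v. X \<in> Q \<Longrightarrow> u \<in> X \<Longrightarrow> v \<in> X \<Longrightarrow> x $ u = x $ v"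
  shows "x \<in> span (indicator_vec ` Q)"
proof -
  \<comment> \<open>The common value of \<open>x\<close> on the block, read off at an arbitrary
    representative.\<close>
  define c where "c X = x $ (SOME i. i \<in> X)" for X
  have "x = (\<Sum>X\<in>Q. c X *\<^sub>R indicator_vec X)"
  proof (rule vec_eq_iff[THEN iffD2, rule_format])
    fix i
    obtain Y where Y: "Y \<in> Q" "i \<in> Y"
      using partition_onD1[OF assms(1)] by blast
    have other: "i \<notin> X" if "X \<in> Q" "X \<noteq> Y" for X
      using that Y partition_onD2[OF assms(1)] by (auto simp: disjoint_def)
    have "(\<Sum>X\<in>Q. c X *\<^sub>R indicator_vec X) $ i = (\<Sum>X\<in>Q. if X = Y then c Y else 0)"
      unfolding sum_component by (rule sum.cong) (use Y other in auto)
    also have "\<dots> = c Y"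
      using Y by simp
    also have "\<dots> = x $ i"
      unfolding c_def using Y by (intro const[OF Y(1)]) (auto intro: someI)
    finally show "x $ i = (\<Sum>X\<in>Q. c X *\<^sub>R indicator_vec X) $ i" ..
  qed
  then show ?thesis
    by (metis (no_types, lifting) imageI span_base span_scale span_sum)
qed

section \<open>Maximal independent sets and the component count\<close>

text \<open>\<open>B\<close> attains the maximum, and no independent subset of \<open>span B\<close>
  has more elements. This bound also supplies the finiteness that \<open>Max\<close>
  requires.\<close>

lemma max_independent_eq_card:
  assumes "B \<subseteq> A" "independent B" "A \<subseteq> span B"
  shows "max_independent A = card B"
proof -
  have "finite B"
    using assms(2) by (rule independent_imp_finite)
  then have le: "card S \<le> card B" if "S \<subseteq> A" "independent S" for S
    using independent_span_bound[of B S] that assms(3) by auto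
  show ?thesis
    unfolding max_independent_def
  proof (rule Max_eqI)
    show "finite {card S |S. S \<subseteq> A \<and> independent S}"
      by (rule finite_subset[of _ "{..card B}"]) (auto intro: le)
  qed (use le assms in auto)
qed

theorem theorem3p2:
  fixes E :: "'n::finite set set" and k :: nat
  assumes "k \<ge> 1"
    and "uniform_hypergraph k (UNIV :: 'n set) E"
  shows "num_components UNIV E = geometry_connectivity k E \<and>
         geometry_connectivity k E =
           max_independent {x :: real ^ 'n. (\<forall>i. 0 \<le> x $ i) \<and>
             is_eigenpair k (laplacian_tensor k E) 0 (complex_vec x)}"
proof -
  have card: "\<forall>e\<in>E. card e = k"
    using assms(2) by (simp add: uniform_hypergraph_def)
  define A where "A = {x :: real ^ 'n. x \<noteq> 0 \<and> (\<forall>i. 0 \<le> x $ i) \<and>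
       tensor_apply k (laplacian_tensor k E) x = 0}"
  \<comment> \<open>For eigenvalue 0 the right-hand side of the eigenvalue equation vanishes, and
    embedding the reals commutes with the Laplacian.\<close>
  have eigen: "{x :: real ^ 'n. (\<forall>i. 0 \<le> x $ i) \<and>
             is_eigenpair k (laplacian_tensor k E) 0 (complex_vec x)} = A"
    unfolding A_def is_eigenpair_def laplacian_apply_complex_vec[OF card]
    by (auto simp: complex_vec_eq_0_iff zero_vec_def[symmetric])
  define Q where "Q = UNIV // (edge_adjacency E)\<^sup>*"
  have part: "partition_on UNIV Q"
    unfolding Q_def by (rule partition_on_quotient[OF equiv_edge_adjacency_rtrancl])
  have "max_independent A = card (indicator_vec ` Q)"
  proof (rule max_independent_eq_card)
    show "independent (indicator_vec ` Q)"
      using part by (intro independent_indicator_vec) (auto simp: partition_on_def)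
    show "indicator_vec ` Q \<subseteq> A"
    proof (intro image_subsetI)
      fix X assume X: "X \<in> Q"
      \<comment> \<open>An edge lies inside a class or misses it, so the indicator of a class is
        constant on edges.\<close>
      have mem: "u \<in> X \<longleftrightarrow> v \<in> X" if "e \<in> E" "u \<in> e" "v \<in> e" for e u v
      proof -
        have "(u, v) \<in> edge_adjacency E" "(v, u) \<in> edge_adjacency E"
          using that by (auto simp: edge_adjacency_def)
        then show ?thesis
          using X unfolding Q_def
          by (meson equiv_edge_adjacency_rtrancl in_quotient_imp_closed r_into_rtrancl)
      qed
      have "indicator_vec X $ u = indicator_vec X $ v" if "e \<in> E" "u \<in> e" "v \<in> e" for e u v
        unfolding indicator_vec_nth mem[OF that] ..
      then have "tensor_apply k (laplacian_tensor k E) (indicator_vec X) = 0"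
        by (rule constant_on_edges_laplacian_null[OF card])
      moreover have "X \<noteq> {}"
        using X part by (auto simp: partition_on_def)
      ultimately show "indicator_vec X \<in> A"
        by (simp add: A_def indicator_vec_eq_0_iff)
    qed
    show "A \<subseteq> span (indicator_vec ` Q)"
    proof
      fix x assume x: "x \<in> A"
      \<comment> \<open>Constancy on single edges propagates along chains to whole classes.\<close>
      have "x $ u = x $ v" if "(u, v) \<in> (edge_adjacency E)\<^sup>*" for u v
        using that
      proof induction
        case (step y z)
        obtain e where "e \<in> E" "y \<in> e" "z \<in> e"
          using step.hyps(2) unfolding edge_adjacency_def by blast
        then have "x $ y = x $ z"
          using x by (intro laplacian_null_constant_on_edges[OF card]) (auto simp: A_def)
        then show ?case
          using step.IH by simp
      qed simp
      moreover have "(u, v) \<in> (edge_adjacency E)\<^sup>*" if "X \<in> Q" "u \<in> X" "v \<in> X" for X u v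
        using that equiv_edge_adjacency_rtrancl[of E] unfolding Q_def
        by (meson in_quotient_imp_in_rel insert_subset empty_subsetI)
      ultimately show "x \<in> span (indicator_vec ` Q)"
        by (intro span_indicator_vec[OF part]) blast
    qed
  qed
  also have "\<dots> = card Q"
    using inj_indicator_vec by (intro card_image) (auto intro: inj_on_subset)
  also have "\<dots> = num_components UNIV E"
    by (simp add: num_components_def components_eq_quotient Q_def)
  finally have "num_components UNIV E = max_independent A" ..
  then show ?thesis
    unfolding eigen by (simp add: geometry_connectivity_def A_def)
qed

end
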